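(* Let $s,t\ge 2$ be integers, let $\emptyset\subseteq I\subseteq J\subseteq [s-1]\times[t-1]$ be arbitrary and let $B\in\{0,\pm\}^I$. Then: (C1) $\mathsf{P}_{\mathrm{chio}}[\mathcal{E}_B^J]>0$ if and only if the signed graph $(X_B,\sigma_B)$ is balanced. (C2) $\mathsf{P}_{\mathrm{chio}}[\mathcal{E}_B^J]>0$ if and only if $$\mathsf{P}_{\mathrm{chio}}[\mathcal{E}_B^J]=\left(\tfrac12\right)^{\mathrm{dom}(B)+f_0(X_B)-\beta_0(X_B)}=\frac{(1/2)^{\mathrm{dom}(B)}}{\lvert \mathrm{B}^1(X_B;\mathbb{Z}/2)\rvert}.$$ (C3) $\mathsf{P}_{\mathrm{chio}}[\mathcal{E}_B^J]>0$ if and only if $$\mathsf{P}_{\mathrm{chio}}[\mathcal{E}_B^J]=2^{\beta_1(X_B)}\cdot \mathsf{P}_{\mathrm{lcf}}[\mathcal{E}_B^J]=\lvert \mathrm{Z}_1(X_B;\mathbb{Z}/2)\rvert\cdot \mathsf{P}_{\mathrm{lcf}}[\mathcal{E}_B^J].$$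
   Context: Notation: $[n]=\{1,\dots,n\}$, $\{\pm\}=\{-1,+1\}$, $\{0,\pm\}=\{-1,0,+1\}$; $p_1,p_2$ are the projections of $[s-1]\times[t-1]$ to the first and second factor. For $B\in\{0,\pm\}^I$ (a function $I\to\{0,\pm\}$) put $\mathrm{Dom}(B)=I$, $\mathrm{dom}(B)=|I|$, $\mathrm{Supp}(B)=\{(i,j)\in I: B[i,j]\ne0\}$, $\mathrm{supp}(B)=|\mathrm{Supp}(B)|$. Chio extension: for $J\subseteq[s-1]\times[t-1]$, $\breve J:=\{(s,t)\}\cup\{(i,t):i\in p_1(J)\}\cup\{(s,j):j\in p_2(J)\}\cup J\subseteq[s]\times[t]$. Chio map: $\tfrac12 C^{\breve J}_{(s,t)}:\{\pm\}^{\breve J}\to\{0,\pm\}^J$, $A=(a_{i,j})\mapsto\bigl(\tfrac12(a_{i,j}a_{s,t}-a_{i,t}a_{s,j})\bigr)_{(i,j)\in J}$. Chio measure: for $\mathcal{B}\subseteq\{0,\pm\}^J$, $\mathsf{P}_{\mathrm{chio}}[\mathcal{B}]:=2^{-|\breve J|}\sum_{B\in\mathcal{B}}|(\tfrac12C^{\breve J}_{(s,t)})^{-1}(B)|$. Lazy coin flip measure: $\mathsf{P}_{\mathrm{lcf}}$ is the probability measure on $\{0,\pm\}^J$ under which the entries are independent, each taking the values $-1,0,+1$ with probabilities $\tfrac14,\tfrac12,\tfrac14$. Entry-specification event: for $I\subseteq J$ and $B\in\{0,\pm\}^I$, $\mathcal{E}_B^J:=\{\tilde B\in\{0,\pm\}^J:\tilde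 B|_I=B\}$. Signed graph of $B$: $X_B$ is the bipartite simple graph with vertex set $\{(i,t):i\in p_1(I)\}\sqcup\{(s,j):j\in p_2(I)\}$ and edge set $\{\{(i,t),(s,j)\}:(i,j)\in\mathrm{Supp}(B)\}$, and $\sigma_B(\{(i,t),(s,j)\}):=B[i,j]\in\{\pm\}$. A signed graph $(X,\sigma)$ is balanced if every circuit (closed walk without self-intersections) of $X$ contains an even number of edges $e$ with $\sigma(e)=-1$. For a graph $X$: $f_0(X)$ and $f_1(X)$ are the numbers of vertices and edges, $\beta_0(X)$ is the number of connected components, $\mathrm{Z}_1(X;\mathbb{Z}/2)$ is the cycle space over $\mathbb{Z}/2$, $\beta_1(X)=\dim_{\mathbb{Z}/2}\mathrm{Z}_1(X;\mathbb{Z}/2)$, and $\mathrm{B}^1(X;\mathbb{Z}/2)$ is the coboundary (cut) space over $\mathbb{Z}/2$. If $I=\emptyset$ then $X_B$ is the empty graph, with $f_0=\beta_0=\beta_1=0$. *)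

theory Defs
  imports
    "HOL-Probability.Product_PMF"
    "HOL-Library.Z2"
    "HOL-Library.Function_Algebras"
begin

datatype 'v graph = Graph (verts: "'v set") (edges: "'v set set")

definition simple_graph :: "'v graph \<Rightarrow> bool" where
  "simple_graph X \<longleftrightarrow> (\<forall>e\<in>edges X. e \<subseteq> verts X \<and> card e = 2)"

definition f0 :: "'v graph \<Rightarrow> nat" where
  "f0 X = card (verts X)"

definition adj_rel :: "'v graph \<Rightarrow> ('v \<times> 'v) set" where
  "adj_rel X = {(u, v). {u, v} \<in> edges X}"

definition components :: "'v graph \<Rightarrow> 'v set set" where
  "components X = verts X // {(u, v) \<in> verts X \<times> verts X. (u, v) \<in> (adj_rel X)\<^sup>*}"

definition beta0 :: "'v graph \<Rightarrow> nat" where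
  "beta0 X = card (components X)"

text \<open>A circuit is given by the list of its vertices in cyclic order. In a simple graph a closed
  walk without self-intersections visits at least three vertices.\<close>

definition circuit_edges :: "'v list \<Rightarrow> 'v set set" where
  "circuit_edges vs = {{vs ! k, vs ! (Suc k mod length vs)} | k. k < length vs}"

definition circuit :: "'v graph \<Rightarrow> 'v list \<Rightarrow> bool" where
  "circuit X vs \<longleftrightarrow>
     3 \<le> length vs \<and> distinct vs \<and> set vs \<subseteq> verts X \<and> circuit_edges vs \<subseteq> edges X"

definition balanced :: "'v graph \<Rightarrow> ('v set \<Rightarrow> int) \<Rightarrow> bool" where
  "balanced X \<sigma> \<longleftrightarrow> (\<forall>vs. circuit X vs \<longrightarrow> even (card {e \<in> circuit_edges vs. \<sigma> e = -1}))"

text \<open>Chains and cochains are functions into the field \<^typ>\<open>bit\<close> that vanish outside the vertices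
  or edges of the graph; the ambient vector space is the space of all functions.\<close>

global_interpretation bit_fun: vector_space "\<lambda>(c :: bit) (f :: 'a \<Rightarrow> bit) x. c * f x"
  defines bit_dim = bit_fun.dim
  by unfold_locales (auto simp: fun_eq_iff algebra_simps)

definition chains0 :: "'v graph \<Rightarrow> ('v \<Rightarrow> bit) set" where
  "chains0 X = {f. \<forall>v. v \<notin> verts X \<longrightarrow> f v = 0}"

definition chains1 :: "'v graph \<Rightarrow> ('v set \<Rightarrow> bit) set" where
  "chains1 X = {z. \<forall>e. e \<notin> edges X \<longrightarrow> z e = 0}"

definition boundary :: "'v graph \<Rightarrow> ('v set \<Rightarrow> bit) \<Rightarrow> 'v \<Rightarrow> bit" where
  "boundary X z v = (\<Sum>e\<in>{e \<in> edges X. v \<in> e}. z e)"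

definition coboundary :: "'v graph \<Rightarrow> ('v \<Rightarrow> bit) \<Rightarrow> 'v set \<Rightarrow> bit" where
  "coboundary X f e = (if e \<in> edges X then \<Sum>v\<in>e. f v else 0)"

definition cycle_space :: "'v graph \<Rightarrow> ('v set \<Rightarrow> bit) set" where
  "cycle_space X = {z \<in> chains1 X. \<forall>v\<in>verts X. boundary X z v = 0}"

definition coboundary_space :: "'v graph \<Rightarrow> ('v set \<Rightarrow> bit) set" where
  "coboundary_space X = coboundary X ` chains0 X"

definition beta1 :: "'v graph \<Rightarrow> nat" where
  "beta1 X = bit_dim (cycle_space X)"

text \<open>A matrix with index set \<open>I\<close> and entries in \<open>S\<close> is an element of the extensional function
  space \<^term>\<open>I \<rightarrow>\<^sub>E S\<close>. Since such a function does not determine \<open>I\<close>, the index set is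
  always passed separately.\<close>

definition chio_ext :: "nat \<Rightarrow> nat \<Rightarrow> (nat \<times> nat) set \<Rightarrow> (nat \<times> nat) set" where
  "chio_ext s t J = {(s, t)} \<union> {(i, t) | i. i \<in> fst ` J} \<union> {(s, j) | j. j \<in> snd ` J} \<union> J"

text \<open>For entries in \<open>{-1, 1}\<close> the number being halved is even, so the integer division is exact
  (see \<open>two_times_chio_map\<close> below).\<close>

definition chio_map ::
    "nat \<Rightarrow> nat \<Rightarrow> (nat \<times> nat) set \<Rightarrow> (nat \<times> nat \<Rightarrow> int) \<Rightarrow> nat \<times> nat \<Rightarrow> int" where
  "chio_map s t J A =
     (\<lambda>(i, j)\<in>J. (A (i, j) * A (s, t) - A (i, t) * A (s, j)) div 2)"

definition chio_prob :: "nat \<Rightarrow> nat \<Rightarrow> (nat \<times> nat) set \<Rightarrow> (nat \<times> nat \<Rightarrow> int) set \<Rightarrow> real" where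
  "chio_prob s t J \<B> =
     (1 / 2) ^ card (chio_ext s t J) *
     (\<Sum>B\<in>\<B>. real (card {A \<in> chio_ext s t J \<rightarrow>\<^sub>E {-1, 1}. chio_map s t J A = B}))"

definition lazy_coin :: "int pmf" where
  "lazy_coin = pmf_of_multiset {#-1, 0, 0, 1#}"

definition lcf_prob :: "(nat \<times> nat) set \<Rightarrow> (nat \<times> nat \<Rightarrow> int) set \<Rightarrow> real" where
  "lcf_prob J \<B> = measure_pmf.prob (Pi_pmf J undefined (\<lambda>_. lazy_coin)) \<B>"

definition entry_event ::
    "(nat \<times> nat) set \<Rightarrow> (nat \<times> nat) set \<Rightarrow> (nat \<times> nat \<Rightarrow> int) \<Rightarrow> (nat \<times> nat \<Rightarrow> int) set" where
  "entry_event J I B = {B' \<in> J \<rightarrow>\<^sub>E {-1, 0, 1}. restrict B' I = B}"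

definition Supp :: "(nat \<times> nat) set \<Rightarrow> (nat \<times> nat \<Rightarrow> int) \<Rightarrow> (nat \<times> nat) set" where
  "Supp I B = {p \<in> I. B p \<noteq> 0}"

definition entry_edge :: "nat \<Rightarrow> nat \<Rightarrow> nat \<times> nat \<Rightarrow> (nat \<times> nat) set" where
  "entry_edge s t = (\<lambda>(i, j). {(i, t), (s, j)})"

text \<open>For \<^term>\<open>I \<subseteq> {1..s-1} \<times> {1..t-1}\<close> the two kinds of vertices are automatically disjoint.\<close>

definition matrix_graph ::
    "nat \<Rightarrow> nat \<Rightarrow> (nat \<times> nat) set \<Rightarrow> (nat \<times> nat \<Rightarrow> int) \<Rightarrow> (nat \<times> nat) graph" where
  "matrix_graph s t I B =
     Graph ({(i, t) | i. i \<in> fst ` I} \<union> {(s, j) | j. j \<in> snd ` I}) (entry_edge s t ` Supp I B)"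

definition matrix_sign ::
    "nat \<Rightarrow> nat \<Rightarrow> (nat \<times> nat) set \<Rightarrow> (nat \<times> nat \<Rightarrow> int) \<Rightarrow> (nat \<times> nat) set \<Rightarrow> int" where
  "matrix_sign s t I B e = B (inv_into (Supp I B) (entry_edge s t) e)"

lemma pmf_lazy_coin:
  "pmf lazy_coin (-1) = 1 / 4" "pmf lazy_coin 0 = 1 / 2" "pmf lazy_coin 1 = 1 / 4"
  by (simp_all add: lazy_coin_def)

lemma two_times_chio_map:
  assumes A: "A \<in> chio_ext s t J \<rightarrow>\<^sub>E {-1, 1}" and ij: "(i, j) \<in> J"
  shows "2 * chio_map s t J A (i, j) = A (i, j) * A (s, t) - A (i, t) * A (s, j)"
    and "chio_map s t J A (i, j) \<in> {-1, 0, 1}"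
proof -
  have "(i, j) \<in> chio_ext s t J" "(s, t) \<in> chio_ext s t J"
    "(i, t) \<in> chio_ext s t J" "(s, j) \<in> chio_ext s t J"
    using ij by (force simp: chio_ext_def)+
  with A have "A (i, j) \<in> {-1, 1}" "A (s, t) \<in> {-1, 1}" "A (i, t) \<in> {-1, 1}" "A (s, j) \<in> {-1, 1}"
    by (auto dest: PiE_mem)
  then show "2 * chio_map s t J A (i, j) = A (i, j) * A (s, t) - A (i, t) * A (s, j)"
    and "chio_map s t J A (i, j) \<in> {-1, 0, 1}"
    using ij by (auto simp: chio_map_def)
qed

lemma inj_on_entry_edge:
  assumes "I \<subseteq> {1..s-1} \<times> {1..t-1}"
  shows "inj_on (entry_edge s t) I"
proof (rule inj_onI)
  fix p q assume "p \<in> I" "q \<in> I" "entry_edge s t p = entry_edge s t q"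
  with assms have "p \<in> {1..s-1} \<times> {1..t-1}" "q \<in> {1..s-1} \<times> {1..t-1}" by auto
  with \<open>entry_edge s t p = entry_edge s t q\<close> show "p = q"
    by (cases p; cases q) (auto simp: entry_edge_def doubleton_eq_iff)
qed

lemma matrix_sign_entry_edge:
  assumes "I \<subseteq> {1..s-1} \<times> {1..t-1}" "(i, j) \<in> Supp I B"
  shows "matrix_sign s t I B {(i, t), (s, j)} = B (i, j)"
proof -
  have "inj_on (entry_edge s t) (Supp I B)"
    using assms by (intro inj_on_entry_edge) (auto simp: Supp_def)
  from inv_into_f_f[OF this assms(2)] show ?thesis
    by (simp add: matrix_sign_def entry_edge_def)
qed

lemma simple_graph_matrix_graph:
  assumes "I \<subseteq> {1..s-1} \<times> {1..t-1}"
  shows "simple_graph (matrix_graph s t I B)"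
  unfolding simple_graph_def
proof
  fix e assume "e \<in> edges (matrix_graph s t I B)"
  then obtain i j where ij: "(i, j) \<in> Supp I B" and e: "e = {(i, t), (s, j)}"
    by (auto simp: matrix_graph_def entry_edge_def)
  from ij assms have "(i, j) \<in> I" "(i, j) \<in> {1..s-1} \<times> {1..t-1}" by (auto simp: Supp_def)
  moreover from this have "(i, t) \<noteq> (s, j)" by auto
  moreover from \<open>(i, j) \<in> I\<close> have "i \<in> fst ` I" "j \<in> snd ` I" by force+
  ultimately show "e \<subseteq> verts (matrix_graph s t I B) \<and> card e = 2"
    by (simp add: e matrix_graph_def)
qed

end

theory Submission
  imports Defs
begin

text \<open>In the fibre over \<open>B\<close>, the equations at the zero entries of \<open>B\<close> determine the corresponding
  entries of the sign matrix, and the equation at an entry \<open>B[i,j] \<noteq> 0\<close> amounts to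
  \<open>a\<^sub>i\<^sub>j = a\<^sub>s\<^sub>t B[i,j]\<close> together with \<open>a\<^sub>i\<^sub>t a\<^sub>s\<^sub>j = -B[i,j]\<close>. Hence the probability is \<open>2\<close> to the power
  \<open>-|I| - f\<^sub>0\<close> times the number of sign labellings \<open>f\<close> of the vertices of \<open>X\<^sub>B\<close> with prescribed
  coboundary. Since \<open>X\<^sub>B\<close> is bipartite, such an \<open>f\<close> exists iff the coboundary of some labelling is the
  sign function itself, that is, iff \<open>X\<^sub>B\<close> is balanced; and then the solutions form a coset of the kernel
  of the coboundary map, which has \<open>2\<close> to the power \<open>\<beta>\<^sub>0\<close> elements. The identities
  \<open>|B\<^sup>1| 2^\<beta>\<^sub>0 = 2^f\<^sub>0\<close> and \<open>|Z\<^sub>1| |B\<^sup>1| = 2^f\<^sub>1\<close> turn this into the stated formulas.\<close>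

text \<open>These two rules would rewrite the field operations of \<^typ>\<open>bit\<close> to bit operations, on which
  the ring and vector space simplification rules do not fire.\<close>

declare add_bit_eq_xor [simp del] mult_bit_eq_and [simp del]

section \<open>Counting and characters over the field with two elements\<close>

lemma bit_add_self [simp]: "a + a = (0::bit)"
  by (cases a) simp_all

lemma bit_add_eq_0_iff: "a + b = 0 \<longleftrightarrow> a = (b::bit)"
  by (cases a; cases b) simp_all

text \<open>Chains are total functions with value 0 off their support; in the form
  \<open>PiE_dflt\<close> they can be counted as a finite product.\<close>

lemma supported_eq_PiE_dflt: "{f. \<forall>x. x \<notin> S \<longrightarrow> f x = (0::bit)} = PiE_dflt S 0 (\<lambda>_. {0, 1})"
  by (auto simp: PiE_dflt_def)

lemma finite_supported:
  assumes "finite S"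
  shows "finite {f. \<forall>x. x \<notin> S \<longrightarrow> f x = (0::bit)}"
  using assms unfolding supported_eq_PiE_dflt by (intro finite_PiE_dflt) auto

lemma card_supported:
  assumes "finite S"
  shows "card {f. \<forall>x. x \<notin> S \<longrightarrow> f x = (0::bit)} = 2 ^ card S"
  using assms unfolding supported_eq_PiE_dflt by (subst card_PiE_dflt) (simp_all add: numeral_2_eq_2)

text \<open>The only scalars are 0 and 1, so adjoining an independent vector \<open>a\<close> adds
  to the span just its translate by \<open>a\<close>. The translate is disjoint from the old span,
  so the cardinality doubles.\<close>

lemma card_span:
  assumes "finite B" and "bit_fun.independent B"
  shows "finite (bit_fun.span B) \<and> card (bit_fun.span B) = 2 ^ card B"
  using assms
proof (induction B rule: finite_induct)
  case empty
  then show ?case by simp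
next
  case (insert a B)
  let ?S = "bit_fun.span B"
  have a: "a \<notin> ?S" and fin: "finite ?S" and card: "card ?S = 2 ^ card B"
    using insert by (auto simp: bit_fun.independent_insert)
  have span: "bit_fun.span (insert a B) = ?S \<union> (\<lambda>x. x + a) ` ?S"
  proof (rule set_eqI)
    fix x
    have "x \<in> bit_fun.span (insert a B) \<longleftrightarrow> x \<in> ?S \<or> x - a \<in> ?S"
      unfolding bit_fun.span_breakdown_eq
    proof safe
      fix k :: bit assume "x - (\<lambda>y. k * a y) \<in> ?S" "x - a \<notin> ?S"
      then show "x \<in> ?S" by (cases k) (auto simp: fun_diff_def)
    next
      assume "x \<in> ?S" then show "\<exists>k. x - (\<lambda>y. k * a y) \<in> ?S"
        by (intro exI[of _ 0]) (simp add: fun_diff_def)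
    next
      assume "x - a \<in> ?S" then show "\<exists>k. x - (\<lambda>y. k * a y) \<in> ?S"
        by (intro exI[of _ 1]) (simp add: fun_diff_def)
    qed
    also have "x - a \<in> ?S \<longleftrightarrow> x \<in> (\<lambda>x. x + a) ` ?S"
      by (metis (no_types, lifting) add_diff_cancel diff_add_cancel image_iff)
    finally show "x \<in> bit_fun.span (insert a B) \<longleftrightarrow> x \<in> ?S \<union> (\<lambda>x. x + a) ` ?S" by simp
  qed
  have disj: "?S \<inter> (\<lambda>x. x + a) ` ?S = {}"
    using a by (auto simp: bit_fun.span_add_eq)
  have "card (bit_fun.span (insert a B)) = card ?S + card ((\<lambda>x. x + a) ` ?S)"
    unfolding span using fin disj by (intro card_Un_disjoint) auto
  also have "card ((\<lambda>x. x + a) ` ?S) = card ?S"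
    by (rule card_image) (simp add: inj_on_def)
  finally show ?case
    using fin insert.hyps card by (simp add: span)
qed

lemma card_subspace:
  assumes "bit_fun.subspace V" and "finite V"
  shows "card V = 2 ^ bit_dim V"
proof -
  obtain B where B: "B \<subseteq> V" "bit_fun.independent B" "V \<subseteq> bit_fun.span B" "card B = bit_dim V"
    by (rule bit_fun.basis_exists)
  then have "bit_fun.span B = V"
    using assms(1) bit_fun.span_minimal by blast
  then show ?thesis
    using card_span[of B] B assms(2) finite_subset by metis
qed

text \<open>The nontrivial character of the additive group of \<open>bit\<close>. It serves both for
  character sums and for passing from bits to matrix entries.\<close>

definition bit_sign :: "bit \<Rightarrow> int" where
  "bit_sign b = (if b = 0 then 1 else -1)"

lemma bit_sign_0 [simp]: "bit_sign 0 = 1"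
  by (simp add: bit_sign_def)

lemma bit_sign_add: "bit_sign (a + b) = bit_sign a * bit_sign b"
  by (cases a; cases b) (simp_all add: bit_sign_def)

text \<open>Orthogonality of characters. If \<open>h\<close> is nonzero at \<open>x0\<close>,
  toggling \<open>f\<close> at \<open>x0\<close> is an involution that negates every summand, so the
  sum equals its own negative.\<close>

lemma character_sum:
  fixes h :: "'a \<Rightarrow> bit"
  assumes "finite S"
  shows "(\<Sum>f | \<forall>x. x \<notin> S \<longrightarrow> f x = 0. bit_sign (\<Sum>x\<in>S. f x * h x)) =
    (if \<forall>x\<in>S. h x = 0 then 2 ^ card S else 0)"
proof (cases "\<forall>x\<in>S. h x = 0")
  case True
  then show ?thesis by (simp add: card_supported[OF assms])
next
  case False
  then obtain x0 where x0: "x0 \<in> S" "h x0 = 1" by auto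
  let ?F = "{f. \<forall>x. x \<notin> S \<longrightarrow> f x = (0::bit)}"
  let ?\<chi> = "\<lambda>f. bit_sign (\<Sum>x\<in>S. f x * h x)"
  let ?\<phi> = "\<lambda>f :: 'a \<Rightarrow> bit. f(x0 := f x0 + 1)"
  have flip: "?\<chi> (?\<phi> f) = - ?\<chi> f" for f
  proof -
    have "(\<Sum>x\<in>S. ?\<phi> f x * h x) = (f x0 + 1) * h x0 + (\<Sum>x\<in>S - {x0}. f x * h x)"
      using assms x0 by (subst sum.remove[of _ x0]) auto
    also have "\<dots> = (\<Sum>x\<in>S. f x * h x) + 1"
      using assms x0 by (subst (2) sum.remove[of _ x0]) (auto simp: algebra_simps)
    finally show ?thesis by (simp add: bit_sign_add) (simp add: bit_sign_def)
  qed
  have "sum ?\<chi> ?F = (\<Sum>f\<in>?F. ?\<chi> (?\<phi> f))"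
    using x0 by (intro sum.reindex_bij_witness[of _ ?\<phi> ?\<phi>]) (auto simp: add.assoc)
  also have "\<dots> = - sum ?\<chi> ?F"
    by (simp only: flip sum_negf)
  finally show ?thesis using False by simp
qed

section \<open>Cycles and coboundaries over the field with two elements\<close>

text \<open>The kernel of the coboundary map, that is, the zeroth cohomology of the graph.\<close>

definition cocycles0 :: "'v graph \<Rightarrow> ('v \<Rightarrow> bit) set" where
  "cocycles0 X = {f \<in> chains0 X. coboundary X f = (\<lambda>_. 0)}"

lemma finite_edges:
  assumes "simple_graph X" and "finite (verts X)"
  shows "finite (edges X)"
proof (rule finite_subset)
  show "edges X \<subseteq> Pow (verts X)" using assms(1) by (auto simp: simple_graph_def)
qed (use assms in simp)

lemma simple_graph_edgeE:
  assumes "simple_graph X" and "e \<in> edges X"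
  obtains u v where "e = {u, v}" "u \<noteq> v" "u \<in> verts X" "v \<in> verts X"
proof -
  have "card e = 2" "e \<subseteq> verts X" using assms by (auto simp: simple_graph_def)
  then show ?thesis using that by (auto simp: card_2_iff)
qed

lemma simple_graph_edge_doubleton:
  assumes "simple_graph X" and "{u, v} \<in> edges X"
  shows "u \<noteq> v" "u \<in> verts X" "v \<in> verts X"
proof -
  have "card {u, v} = 2" "{u, v} \<subseteq> verts X" using assms by (auto simp: simple_graph_def)
  then show "u \<noteq> v" "u \<in> verts X" "v \<in> verts X" by auto
qed

lemma coboundary_doubleton:
  assumes "simple_graph X" and "{u, v} \<in> edges X"
  shows "coboundary X f {u, v} = f u + f v"
  using simple_graph_edge_doubleton[OF assms] assms(2) by (simp add: coboundary_def)

lemma coboundary_add: "coboundary X (\<lambda>v. f v + g v) e = coboundary X f e + coboundary X g e"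
  by (simp add: coboundary_def sum.distrib)

text \<open>Both sides sum \<open>z e * f v\<close> over all incident pairs of an edge
  \<open>e\<close> and a vertex \<open>v\<close>.\<close>

lemma coboundary_boundary_adjoint:
  assumes "simple_graph X" and "finite (verts X)"
  shows "(\<Sum>e\<in>edges X. z e * coboundary X f e) = (\<Sum>v\<in>verts X. f v * boundary X z v)"
proof -
  have "(\<Sum>e\<in>edges X. z e * coboundary X f e)
      = (\<Sum>e\<in>edges X. \<Sum>v\<in>{v. v \<in> verts X \<and> v \<in> e}. z e * f v)"
  proof (rule sum.cong[OF refl])
    fix e assume "e \<in> edges X"
    moreover from this have "{v. v \<in> verts X \<and> v \<in> e} = e"
      using assms(1) by (auto simp: simple_graph_def)
    ultimately show "z e * coboundary X f e = (\<Sum>v\<in>{v. v \<in> verts X \<and> v \<in> e}. z e * f v)"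
      by (simp add: coboundary_def sum_distrib_left)
  qed
  also have "\<dots> = (\<Sum>v\<in>verts X. \<Sum>e\<in>{e. e \<in> edges X \<and> v \<in> e}. z e * f v)"
    by (rule sum.swap_restrict) (use assms finite_edges in auto)
  also have "\<dots> = (\<Sum>v\<in>verts X. f v * boundary X z v)"
    by (simp add: boundary_def sum_distrib_left mult.commute)
  finally show ?thesis .
qed

text \<open>Summing the character \<open>(-1)\<^bsup>\<langle>z, \<delta>f\<rangle>\<^esup> = (-1)\<^bsup>\<langle>\<partial>z, f\<rangle>\<^esup>\<close>
  over all pairs \<open>(z, f)\<close> in either order replaces the rank-nullity argument for a map and its
  transpose.\<close>

lemma card_cycle_space_cocycles0:
  assumes "simple_graph X" and "finite (verts X)"
  shows "card (cycle_space X) * 2 ^ card (verts X) = card (cocycles0 X) * 2 ^ card (edges X)"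
proof -
  note finE = finite_edges[OF assms]
  let ?\<chi> = "\<lambda>z f. bit_sign (\<Sum>e\<in>edges X. z e * coboundary X f e)"
  have fin0: "finite (chains0 X)" and fin1: "finite (chains1 X)"
    using finite_supported assms(2) finE by (auto simp: chains0_def chains1_def)
  \<comment> \<open>For fixed \<open>z\<close>, adjointness makes the summand a character in
    \<open>f\<close>, whose sum singles out the cycles. For fixed \<open>f\<close>, the sum over
    \<open>z\<close> singles out the cocycles.\<close>
  have *: "(\<Sum>f\<in>chains0 X. ?\<chi> z f)
      = (if \<forall>v\<in>verts X. boundary X z v = 0 then 2 ^ card (verts X) else 0)" for z
    unfolding coboundary_boundary_adjoint[OF assms] chains0_def
    by (rule character_sum[OF assms(2)])
  have "(\<Sum>z\<in>chains1 X. \<Sum>f\<in>chains0 X. ?\<chi> z f)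
      = int (card (cycle_space X) * 2 ^ card (verts X))"
    unfolding * using fin1 by (simp add: sum.If_cases cycle_space_def Int_def conj_commute)
  moreover have "(\<Sum>z\<in>chains1 X. ?\<chi> z f)
      = (if coboundary X f = (\<lambda>_. 0) then 2 ^ card (edges X) else 0)" for f
  proof -
    have "coboundary X f = (\<lambda>_. 0) \<longleftrightarrow> (\<forall>e\<in>edges X. coboundary X f e = 0)"
      by (auto simp: fun_eq_iff coboundary_def)
    then show ?thesis
      using character_sum[OF finE, of "coboundary X f"] by (simp add: chains1_def)
  qed
  then have "(\<Sum>f\<in>chains0 X. \<Sum>z\<in>chains1 X. ?\<chi> z f)
      = int (card (cocycles0 X) * 2 ^ card (edges X))"
    using fin0 by (simp add: sum.If_cases cocycles0_def Int_def conj_commute)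
  ultimately show ?thesis
    using sum.swap[of ?\<chi> "chains0 X" "chains1 X"] by (metis of_nat_eq_iff)
qed

text \<open>Translation by the particular solution \<open>f1\<close> carries the kernel onto the
  fibre; in characteristic 2 it is its own inverse.\<close>

lemma card_coboundary_fibre:
  assumes "f1 \<in> chains0 X" and "coboundary X f1 = g"
  shows "card {f \<in> chains0 X. coboundary X f = g} = card (cocycles0 X)"
proof -
  have "bij_betw (\<lambda>f v. f v + f1 v) (cocycles0 X) {f \<in> chains0 X. coboundary X f = g}"
    using assms
    by (intro bij_betw_byWitness[where f' = "\<lambda>f v. f v + f1 v"])
      (auto simp: cocycles0_def chains0_def fun_eq_iff coboundary_add add.assoc)
  then show ?thesis by (rule bij_betw_same_card[symmetric])
qed

lemma card_coboundary_space_cocycles0: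
  assumes "finite (verts X)"
  shows "card (coboundary_space X) * card (cocycles0 X) = 2 ^ card (verts X)"
proof -
  have fin: "finite (chains0 X)" using finite_supported[OF assms] by (simp add: chains0_def)
  have "2 ^ card (verts X) = card (chains0 X)"
    using card_supported[OF assms] by (simp add: chains0_def)
  also have "\<dots> = (\<Sum>g\<in>coboundary_space X. card {f \<in> chains0 X. coboundary X f = g})"
    unfolding coboundary_space_def card_eq_sum by (rule sum.image_gen[OF fin])
  also have "\<dots> = (\<Sum>g\<in>coboundary_space X. card (cocycles0 X))"
    by (rule sum.cong[OF refl]) (auto simp: coboundary_space_def card_coboundary_fibre)
  finally show ?thesis by simp
qed

lemma equiv_reachable: "equiv (verts X) {(u, v) \<in> verts X \<times> verts X. (u, v) \<in> (adj_rel X)\<^sup>*}"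
proof (rule equivI)
  have "sym (adj_rel X)" by (auto simp: sym_def adj_rel_def insert_commute)
  then have "sym ((adj_rel X)\<^sup>*)" by (rule sym_rtrancl)
  then show "sym {(u, v) \<in> verts X \<times> verts X. (u, v) \<in> (adj_rel X)\<^sup>*}"
    by (auto simp: sym_def)
qed (auto simp: refl_on_def intro!: transI intro: rtrancl_trans)

lemma cocycles0_iff_adjacent:
  assumes "simple_graph X"
  shows "f \<in> cocycles0 X \<longleftrightarrow>
    f \<in> chains0 X \<and> (\<forall>u v. (u, v) \<in> adj_rel X \<longrightarrow> f u = f v)"
proof -
  have "coboundary X f = (\<lambda>_. 0) \<longleftrightarrow> (\<forall>u v. {u, v} \<in> edges X \<longrightarrow> f u + f v = 0)"
  proof
    assume "coboundary X f = (\<lambda>_. 0)"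
    then show "\<forall>u v. {u, v} \<in> edges X \<longrightarrow> f u + f v = 0"
      using coboundary_doubleton[OF assms, of _ _ f] by metis
  next
    assume R: "\<forall>u v. {u, v} \<in> edges X \<longrightarrow> f u + f v = 0"
    show "coboundary X f = (\<lambda>_. 0)"
    proof
      fix e show "coboundary X f e = 0"
      proof (cases "e \<in> edges X")
        case True
        then show ?thesis
          using simple_graph_edgeE[OF assms True] R coboundary_doubleton[OF assms] by metis
      qed (simp add: coboundary_def)
    qed
  qed
  then show ?thesis by (simp add: cocycles0_def adj_rel_def bit_add_eq_0_iff)
qed

text \<open>A cocycle is constant along edges, hence on components, so it is the indicator of an
  arbitrary set of components.\<close>

lemma card_cocycles0:
  assumes "simple_graph X" and "finite (verts X)"
  shows "card (cocycles0 X) = 2 ^ beta0 X"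
proof -
  let ?r = "{(u, v) \<in> verts X \<times> verts X. (u, v) \<in> (adj_rel X)\<^sup>*}"
  note equiv = equiv_reachable[of X]
  have fin: "finite (components X)"
    unfolding components_def using assms(2) by (intro finite_quotient) auto
  have const: "f u = f v" if "f \<in> cocycles0 X" "(u, v) \<in> (adj_rel X)\<^sup>*" for f u v
    using that(2) by induction (use that(1) cocycles0_iff_adjacent[OF assms(1)] in auto)
  define ind :: "'a set set \<Rightarrow> 'a \<Rightarrow> bit" where "ind S = (\<lambda>v. of_bool (v \<in> \<Union>S))" for S
  have Un: "\<Union>(components X) = verts X"
    unfolding components_def by (rule Union_quotient[OF equiv])
  have comp: "v \<in> C" if "C \<in> components X" "u \<in> C" "(u, v) \<in> (adj_rel X)\<^sup>*" "v \<in> verts X" for u v C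
  proof -
    have "u \<in> verts X" using that(1,2) Un by auto
    then have "(u, v) \<in> ?r" using that by auto
    then show ?thesis using that(1,2) equiv unfolding components_def
      by (meson in_quotient_imp_closed)
  qed
  have disj: "C = D" if "C \<in> components X" "D \<in> components X" "v \<in> C" "v \<in> D" for C D v
    using quotient_disj[OF equiv] that unfolding components_def by blast
  have ind: "ind S \<in> cocycles0 X" if "S \<subseteq> components X" for S
    unfolding cocycles0_iff_adjacent[OF assms(1)]
  proof (intro conjI allI impI)
    show "ind S \<in> chains0 X" using that Un by (auto simp: ind_def chains0_def)
    fix u v assume uv: "(u, v) \<in> adj_rel X"
    then have "(v, u) \<in> adj_rel X" "u \<in> verts X" "v \<in> verts X"
      using simple_graph_edge_doubleton[OF assms(1)] by (auto simp: adj_rel_def insert_commute)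
    then have "u \<in> \<Union>S \<longleftrightarrow> v \<in> \<Union>S" using that uv comp by blast
    then show "ind S u = ind S v" by (simp add: ind_def)
  qed
  have "bij_betw ind (Pow (components X)) (cocycles0 X)"
  proof (rule bij_betw_byWitness[where f' = "\<lambda>f. {C \<in> components X. \<forall>v\<in>C. f v = 1}"])
    \<comment> \<open>An empty component would meet the condition of the inverse map vacuously;
      nonemptiness lets \<open>S\<close> be recovered from \<open>ind S\<close>.\<close>
    have "C \<noteq> {}" if "C \<in> components X" for C
      using that in_quotient_imp_non_empty[OF equiv] by (simp add: components_def)
    then show "\<forall>S\<in>Pow (components X). {C \<in> components X. \<forall>v\<in>C. ind S v = 1} = S"
      using disj by (fastforce simp: ind_def)
    show "\<forall>f\<in>cocycles0 X. ind {C \<in> components X. \<forall>v\<in>C. f v = 1} = f"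
    proof (intro ballI ext)
      fix f v assume f: "f \<in> cocycles0 X"
      show "ind {C \<in> components X. \<forall>v\<in>C. f v = 1} v = f v"
      proof (cases "v \<in> verts X")
        case True
        then obtain C where C: "C \<in> components X" "v \<in> C" using Un by auto
        have constC: "f u = f v" if "u \<in> C" for u
        proof -
          have "(u, v) \<in> ?r" using C that equiv unfolding components_def
            by (meson in_quotient_imp_in_rel empty_subsetI insert_subset)
          then show ?thesis using const[OF f] by auto
        qed
        have "v \<in> \<Union>{C \<in> components X. \<forall>v\<in>C. f v = 1} \<longleftrightarrow> f v = 1"
        proof
          assume "f v = 1"
          then have "\<forall>u\<in>C. f u = 1" using constC by simp
          then show "v \<in> \<Union>{C \<in> components X. \<forall>v\<in>C. f v = 1}" using C by blast
        qed blast
        then show ?thesis by (cases "f v") (auto simp: ind_def)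
      next
        case False
        then show ?thesis using f Un by (auto simp: ind_def cocycles0_def chains0_def)
      qed
    qed
  qed (use ind in auto)
  then have "card (cocycles0 X) = card (Pow (components X))"
    by (rule bij_betw_same_card[symmetric])
  then show ?thesis by (simp add: card_Pow[OF fin] beta0_def)
qed

lemma card_coboundary_space:
  assumes "simple_graph X" and "finite (verts X)"
  shows "card (coboundary_space X) * 2 ^ beta0 X = 2 ^ f0 X"
  using card_coboundary_space_cocycles0[OF assms(2)] card_cocycles0[OF assms] by (simp add: f0_def)

lemma card_cycle_space:
  assumes "simple_graph X" and "finite (verts X)"
  shows "card (cycle_space X) = 2 ^ beta1 X"
  unfolding beta1_def
proof (rule card_subspace)
  show "finite (cycle_space X)"
    using finite_supported[OF finite_edges[OF assms]]
    by (rule finite_subset[rotated]) (auto simp: cycle_space_def chains1_def)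
  show "bit_fun.subspace (cycle_space X)"
    by (rule bit_fun.subspaceI)
      (auto simp: cycle_space_def chains1_def boundary_def sum.distrib simp flip: sum_distrib_left)
qed

text \<open>The number of cocycles occurs in both preceding counts; being a power of 2, it can be
  cancelled.\<close>

lemma card_cycle_space_coboundary_space:
  assumes "simple_graph X" and "finite (verts X)"
  shows "card (cycle_space X) * card (coboundary_space X) = 2 ^ card (edges X)"
proof -
  have "card (cycle_space X) * card (coboundary_space X) * card (cocycles0 X)
      = card (cocycles0 X) * 2 ^ card (edges X)"
    using card_cycle_space_cocycles0[OF assms] card_coboundary_space_cocycles0[OF assms(2)]
    by (simp add: mult.assoc)
  then show ?thesis using card_cocycles0[OF assms] by simp
qed

section \<open>Balance and potentials\<close>

text \<open>Induction along the walk: a new vertex is appended, and a vertex already visited cuts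
  the path back to it.\<close>

lemma rtrancl_distinct_path:
  assumes "(u, v) \<in> R\<^sup>*"
  obtains xs where "xs \<noteq> []" "hd xs = u" "last xs = v" "distinct xs"
    "successively (\<lambda>a b. (a, b) \<in> R) xs"
proof -
  let ?path = "\<lambda>v xs. xs \<noteq> [] \<and> hd xs = u \<and> last xs = v \<and> distinct xs \<and>
    successively (\<lambda>a b. (a, b) \<in> R) xs"
  have "\<exists>xs. ?path v xs"
    using assms
  proof induction
    case base
    show ?case by (intro exI[of _ "[u]"]) simp
  next
    case (step y z)
    then obtain xs where xs: "?path y xs" by blast
    show ?case
    proof (cases "z \<in> set xs")
      case True
      then obtain ys zs where "xs = ys @ z # zs" by (auto simp: in_set_conv_decomp)
      then show ?thesis using xs
        by (intro exI[of _ "ys @ [z]"]) (auto simp: successively_append_iff hd_append)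
    next
      case False
      then show ?thesis using xs step.hyps(2)
        by (intro exI[of _ "xs @ [z]"]) (auto simp: successively_append_iff)
    qed
  qed
  then show ?thesis using that by blast
qed

text \<open>Interior values occur twice and cancel in characteristic 2. This evaluates a coboundary
  along a path.\<close>

lemma bit_telescope: "(\<Sum>k<n. f k + f (Suc k)) = f 0 + (f n :: bit)"
proof (induction n)
  case (Suc n)
  have "(\<Sum>k<Suc n. f k + f (Suc k)) = f 0 + (f n + f n) + f (Suc n)"
    using Suc by (simp add: add.assoc)
  then show ?case by simp
qed simp

lemma circuit_edges_eq:
  assumes "vs \<noteq> []"
  shows "circuit_edges vs =
    insert {last vs, hd vs} ((\<lambda>k. {vs ! k, vs ! Suc k}) ` {..<length vs - 1})"
proof -
  obtain m where m: "length vs = Suc m" using assms by (cases "length vs") auto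
  have "circuit_edges vs = (\<lambda>k. {vs ! k, vs ! (Suc k mod length vs)}) ` {..<Suc m}"
    by (auto simp: circuit_edges_def m)
  also have "{..<Suc m} = insert m {..<m}" by (rule lessThan_Suc)
  also have "(\<lambda>k. {vs ! k, vs ! (Suc k mod length vs)}) ` \<dots>
      = insert {last vs, hd vs} ((\<lambda>k. {vs ! k, vs ! Suc k}) ` {..<m})"
    using assms m by (simp add: last_conv_nth hd_conv_nth)
  finally show ?thesis by (simp add: m)
qed

text \<open>Distinct vertices make the path edges distinct. Length at least 3 keeps the closing edge
  apart from them: on two vertices it would coincide with the single path edge.\<close>

lemma sum_circuit_edges:
  assumes "3 \<le> length vs" and "distinct vs"
  shows "sum g (circuit_edges vs) =
    g {last vs, hd vs} + (\<Sum>k<length vs - 1. g {vs ! k, vs ! Suc k})"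
proof -
  have ne: "vs \<noteq> []" using assms(1) by auto
  have nth: "vs ! a = vs ! b \<longleftrightarrow> a = b" if "a < length vs" "b < length vs" for a b
    using that assms(2) nth_eq_iff_index_eq by blast
  have inj: "inj_on (\<lambda>k. {vs ! k, vs ! Suc k}) {..<length vs - 1}"
  proof (rule inj_onI)
    fix a b assume "a \<in> {..<length vs - 1}" "b \<in> {..<length vs - 1}"
      "{vs ! a, vs ! Suc a} = {vs ! b, vs ! Suc b}"
    then show "a = b"
      using nth[of a b] nth[of a "Suc b"] nth[of "Suc a" b] nth[of "Suc a" "Suc b"]
      unfolding doubleton_eq_iff by auto
  qed
  have "{last vs, hd vs} \<noteq> {vs ! k, vs ! Suc k}" if "k < length vs - 1" for k
    using that assms(1) nth[of "length vs - 1" k] nth[of "length vs - 1" "Suc k"] nth[of 0 k]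
      nth[of 0 "Suc k"] ne unfolding doubleton_eq_iff
    by (auto simp: last_conv_nth hd_conv_nth)
  then have "{last vs, hd vs} \<notin> (\<lambda>k. {vs ! k, vs ! Suc k}) ` {..<length vs - 1}" by auto
  then show ?thesis
    unfolding circuit_edges_eq[OF ne] using inj by (simp add: sum.reindex)
qed

text \<open>Insert the edges one at a time. An edge within a component closes a path to a circuit,
  so the old potential already fits it; an edge joining two components is fitted by shifting the
  potential on one of them.\<close>

lemma potential_if_circuit_sums_0:
  fixes g :: "'v set \<Rightarrow> bit"
  assumes "finite E" and "\<forall>e\<in>E. e \<subseteq> V \<and> card e = 2"
    and "\<And>vs. circuit (Graph V E) vs \<Longrightarrow> sum g (circuit_edges vs) = 0"
  shows "\<exists>f. \<forall>u v. {u, v} \<in> E \<longrightarrow> f u + f v = g {u, v}"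
  using assms
proof (induction E rule: finite_induct)
  case empty
  then show ?case by simp
next
  case (insert e E)
  have "circuit (Graph V (insert e E)) vs" if "circuit (Graph V E) vs" for vs
    using that by (auto simp: circuit_def)
  then obtain f where f: "{u, v} \<in> E \<Longrightarrow> f u + f v = g {u, v}" for u v
    using insert.IH insert.prems by auto
  have EV: "e' \<subseteq> V" if "e' \<in> E" for e' using insert.prems(1) that by simp
  obtain u v where e: "e = {u, v}" "u \<noteq> v" "u \<in> V" "v \<in> V"
    using insert.prems(1) by (auto simp: card_2_iff)
  define R where "R = adj_rel (Graph V E)"
  have R: "(a, b) \<in> R \<longleftrightarrow> {a, b} \<in> E" for a b by (simp add: R_def adj_rel_def)
  show ?case
  proof (cases "(u, v) \<in> R\<^sup>*")
    case True
    then obtain xs where xs: "xs \<noteq> []" "hd xs = u" "last xs = v" "distinct xs"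
      and path: "successively (\<lambda>a b. (a, b) \<in> R) xs"
      by (rule rtrancl_distinct_path)
    have step: "{xs ! k, xs ! Suc k} \<in> E" if "k < length xs - 1" for k
      using path that R by (auto simp: successively_conv_nth)
    \<comment> \<open>One vertex would force \<open>u = v\<close>; two would make the new edge
      \<open>e\<close> a member of \<open>E\<close>.\<close>
    have "length xs \<noteq> 1" using xs e by (auto simp: length_Suc_conv)
    moreover have "length xs \<noteq> 2"
      using xs step[of 0] insert.hyps(2) e by (auto simp: hd_conv_nth last_conv_nth)
    ultimately have len: "3 \<le> length xs" using xs(1) by (cases "length xs") auto
    have "xs ! k \<in> V" if "k < length xs" for k
    proof (cases "k = length xs - 1")
      case True
      then show ?thesis using xs e by (simp add: last_conv_nth)
    next
      case False
      then have "k < length xs - 1" using that by linarith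
      then have "{xs ! k, xs ! Suc k} \<subseteq> V" using EV step by metis
      then show ?thesis by simp
    qed
    then have "set xs \<subseteq> V" by (auto simp: in_set_conv_nth)
    moreover have "circuit_edges xs \<subseteq> insert e E"
      unfolding circuit_edges_eq[OF xs(1)] using step xs e by auto
    ultimately have "circuit (Graph V (insert e E)) xs"
      using len xs by (simp add: circuit_def)
    then have "0 = g {v, u} + (\<Sum>k<length xs - 1. g {xs ! k, xs ! Suc k})"
      using insert.prems(2) sum_circuit_edges[OF len xs(4), of g] xs by simp
    also have "(\<Sum>k<length xs - 1. g {xs ! k, xs ! Suc k})
        = (\<Sum>k<length xs - 1. f (xs ! k) + f (xs ! Suc k))"
      using step f by (intro sum.cong) auto
    also have "\<dots> = f u + f v"
      using xs bit_telescope[of "\<lambda>k. f (xs ! k)"] by (simp add: hd_conv_nth last_conv_nth)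
    finally have "g {v, u} = f u + f v" by (metis bit_add_eq_0_iff)
    then show ?thesis
      using f e by (intro exI[of _ f]) (auto simp: doubleton_eq_iff insert_commute add.commute)
  next
    case False
    \<comment> \<open>\<open>c\<close> is the defect of \<open>f\<close> at \<open>e\<close>. Adding
      it on the component of \<open>u\<close> does not affect an edge of \<open>E\<close>, whose
      ends are both reachable from \<open>u\<close> or both not, and it repairs \<open>e\<close>
      because \<open>v\<close> is not reachable.\<close>
    define c where "c = f u + f v + g e"
    define f' where "f' w = f w + (if (u, w) \<in> R\<^sup>* then c else 0)" for w
    have 1: "f' a + f' b = g {a, b}" if ab: "{a, b} \<in> E" for a b
    proof -
      have "(a, b) \<in> R" "(b, a) \<in> R" using ab by (simp_all add: R insert_commute)
      then have "(u, a) \<in> R\<^sup>* \<longleftrightarrow> (u, b) \<in> R\<^sup>*" by (meson rtrancl.rtrancl_into_rtrancl)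
      then have "f' a + f' b = f a + f b" by (cases c) (auto simp: f'_def algebra_simps)
      then show ?thesis using f[OF ab] by simp
    qed
    have 2: "f' u + f' v = g e"
      using False unfolding f'_def c_def
      by (cases "f u"; cases "f v"; cases "g e") simp_all
    show ?thesis
      using 1 2 e by (intro exI[of _ f']) (auto simp: doubleton_eq_iff insert_commute add.commute)
  qed
qed

lemma of_nat_bit_eq_0_iff: "(of_nat n :: bit) = 0 \<longleftrightarrow> even n"
  by (induction n) auto

text \<open>The parity of the negative edges on a circuit is the sum of their indicator over the
  circuit. If all these sums vanish, a potential exists; conversely, a coboundary telescopes to 0
  around every circuit.\<close>

lemma balanced_iff_coboundary:
  assumes "simple_graph X" and "finite (verts X)"
  shows "balanced X \<sigma> \<longleftrightarrow>
    (\<exists>f\<in>chains0 X. \<forall>e\<in>edges X. coboundary X f e = of_bool (\<sigma> e = -1))"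
proof -
  let ?g = "\<lambda>e. of_bool (\<sigma> e = -1) :: bit"
  have parity: "even (card {e \<in> circuit_edges vs. \<sigma> e = -1}) \<longleftrightarrow> sum ?g (circuit_edges vs) = 0"
    for vs :: "'a list"
  proof -
    have "finite (circuit_edges vs)" by (cases vs) (auto simp: circuit_edges_def)
    then show ?thesis by (simp add: of_nat_bit_eq_0_iff Int_def)
  qed
  show ?thesis
  proof
    assume "balanced X \<sigma>"
    then have "sum ?g (circuit_edges vs) = 0" if "circuit (Graph (verts X) (edges X)) vs" for vs
      using that by (simp add: balanced_def parity)
    then obtain f where f: "\<And>u v. {u, v} \<in> edges X \<Longrightarrow> f u + f v = ?g {u, v}"
      using potential_if_circuit_sums_0[of "edges X" "verts X" ?g] finite_edges[OF assms] assms(1)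
      by (auto simp: simple_graph_def)
    \<comment> \<open>The potential is arbitrary off the vertices; the value 0 there makes it a
      chain and leaves its coboundary unchanged.\<close>
    define f' where "f' v = (if v \<in> verts X then f v else 0)" for v
    have "coboundary X f' e = ?g e" if "e \<in> edges X" for e
    proof -
      obtain u v where "e = {u, v}" "u \<in> verts X" "v \<in> verts X"
        using simple_graph_edgeE[OF assms(1) \<open>e \<in> edges X\<close>] by metis
      then show ?thesis using that f coboundary_doubleton[OF assms(1), of u v f']
        by (simp add: f'_def)
    qed
    then show "\<exists>f\<in>chains0 X. \<forall>e\<in>edges X. coboundary X f e = ?g e"
      by (intro bexI[of _ f']) (auto simp: chains0_def f'_def)
  next
    assume "\<exists>f\<in>chains0 X. \<forall>e\<in>edges X. coboundary X f e = ?g e"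
    then obtain f where f: "\<forall>e\<in>edges X. coboundary X f e = ?g e" by blast
    have "sum ?g (circuit_edges vs) = 0" if C: "circuit X vs" for vs
    proof -
      have len: "3 \<le> length vs" and "distinct vs" and ne: "vs \<noteq> []"
        and sub: "circuit_edges vs \<subseteq> edges X"
        using C by (auto simp: circuit_def)
      have "sum ?g (circuit_edges vs) = sum (coboundary X f) (circuit_edges vs)"
        using f sub by (intro sum.cong) auto
      also have "\<dots> = coboundary X f {last vs, hd vs}
          + (\<Sum>k<length vs - 1. coboundary X f {vs ! k, vs ! Suc k})"
        by (rule sum_circuit_edges) fact+
      also have "\<dots> = f (last vs) + f (hd vs) + (\<Sum>k<length vs - 1. f (vs ! k) + f (vs ! Suc k))"
        using sub unfolding circuit_edges_eq[OF ne]
        by (intro arg_cong2[where f = "(+)"] sum.cong coboundary_doubleton[OF assms(1)]) auto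
      also have "\<dots> = 0"
        unfolding bit_telescope[of "\<lambda>k. f (vs ! k)"] using ne
        by (simp add: hd_conv_nth last_conv_nth bit_add_eq_0_iff add.commute)
      finally show ?thesis .
    qed
    then show "balanced X \<sigma>" by (simp add: balanced_def parity)
  qed
qed

section \<open>Fibres of the Chio map\<close>

lemma finite_chio_ext: "finite J \<Longrightarrow> finite (chio_ext s t J)"
  by (simp add: chio_ext_def setcompr_eq_image)

text \<open>Vertices lie in row \<open>s\<close> or column \<open>t\<close>, which \<open>I\<close>
  avoids. So the vertices and \<open>I\<close> are disjoint blocks of the Chio extension.\<close>

lemma verts_matrix_graph_subset:
  assumes "I \<subseteq> J" and "J \<subseteq> {1..s-1} \<times> {1..t-1}"
  shows "verts (matrix_graph s t I B) \<subseteq> chio_ext s t J - I"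
proof -
  have bound: "i < s" "j < t" if "(i, j) \<in> I" for i j using that assms by fastforce+
  have "verts (matrix_graph s t I B) \<subseteq> chio_ext s t J"
    using assms(1) by (auto simp: matrix_graph_def chio_ext_def)
  moreover have "verts (matrix_graph s t I B) \<inter> I = {}"
    by (fastforce simp: matrix_graph_def dest: bound)
  ultimately show ?thesis by blast
qed

lemma chio_map_in_PiE:
  assumes "A \<in> chio_ext s t J \<rightarrow>\<^sub>E {-1, 1}"
  shows "chio_map s t J A \<in> J \<rightarrow>\<^sub>E {-1, 0, 1}"
proof (rule PiE_I)
  fix p assume "p \<in> J"
  then show "chio_map s t J A p \<in> {-1, 0, 1}"
    using two_times_chio_map(2)[OF assms] by (cases p) blast
qed (simp add: chio_map_def)

text \<open>The fibres over the members of the event are disjoint, so their sizes add up to one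
  count of sign matrices. Chio images always have entries in range, so only the equations on
  \<open>I\<close> remain.\<close>

lemma chio_prob_entry_event:
  assumes "finite J" and "I \<subseteq> J" and "B \<in> extensional I"
  shows "chio_prob s t J (entry_event J I B) = (1 / 2) ^ card (chio_ext s t J) *
    real (card {A \<in> chio_ext s t J \<rightarrow>\<^sub>E {-1, 1}. \<forall>p\<in>I. chio_map s t J A p = B p})"
proof -
  let ?M = "chio_ext s t J \<rightarrow>\<^sub>E {-1, 1 :: int}"
  let ?S = "{A \<in> ?M. \<forall>p\<in>I. chio_map s t J A p = B p}"
  let ?C = "chio_map s t J"
  have finS: "finite ?S" using assms(1) by (auto intro!: finite_PiE finite_chio_ext)
  have finE: "finite (entry_event J I B)"
    unfolding entry_event_def using assms(1) by (auto intro!: finite_PiE)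
  have mem: "?C A \<in> entry_event J I B \<longleftrightarrow> (\<forall>p\<in>I. ?C A p = B p)" if "A \<in> ?M" for A
  proof -
    have "restrict (?C A) I = B \<longleftrightarrow> (\<forall>p\<in>I. ?C A p = B p)"
      using assms(3) by (auto simp: fun_eq_iff restrict_def extensional_def)
    then show ?thesis using chio_map_in_PiE[OF that] by (simp add: entry_event_def)
  qed
  have "(\<Sum>B'\<in>entry_event J I B. card {A \<in> ?M. ?C A = B'})
      = (\<Sum>B'\<in>entry_event J I B. \<Sum>A\<in>{A \<in> ?S. ?C A = B'}. 1)"
    using mem by (intro sum.cong) (auto intro!: arg_cong[where f = card])
  also have "\<dots> = card ?S"
    using mem by (subst sum.group[OF finS finE]) auto
  finally show ?thesis unfolding chio_prob_def of_nat_sum[symmetric] by simp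
qed

text \<open>Two signs differ by \<open>2 * b\<close> with \<open>b\<close> nonzero only if the first
  is \<open>b\<close> and the second \<open>- b\<close>; they differ by 0 only if equal.
  Multiplication by the sign \<open>a\<^sub>0\<close> then solves for \<open>a\<close>.\<close>

lemma chio_entry_iff:
  fixes a a\<^sub>0 x y b :: int
  assumes "a \<in> {-1, 1}" "a\<^sub>0 \<in> {-1, 1}" "x \<in> {-1, 1}" "y \<in> {-1, 1}" "b \<in> {-1, 0, 1}"
  shows "(a * a\<^sub>0 - x * y) div 2 = b \<longleftrightarrow>
    a = a\<^sub>0 * (if b = 0 then x * y else b) \<and> (b \<noteq> 0 \<longrightarrow> x * y = - b)"
  using assms by auto

text \<open>Under \<open>bit_sign\<close>, the equation \<open>x * y = - b\<close> says that the two
  bits sum to 1 exactly when \<open>b = 1\<close>; hence the test for 1 and not for -1.\<close>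

definition switchings ::
    "nat \<Rightarrow> nat \<Rightarrow> (nat \<times> nat) set \<Rightarrow> (nat \<times> nat \<Rightarrow> int) \<Rightarrow> (nat \<times> nat \<Rightarrow> bit) set" where
  "switchings s t I B = {f \<in> chains0 (matrix_graph s t I B).
     \<forall>(i, j)\<in>Supp I B. f (i, t) + f (s, j) = of_bool (B (i, j) = 1)}"

text \<open>Once the column \<open>t\<close> and the row \<open>s\<close> are chosen on the vertices of \<open>X\<^sub>B\<close>, the entries on \<open>I\<close>
  are determined by \<open>B\<close>, and all other entries are unconstrained.\<close>

lemma card_chio_fibre:
  assumes "I \<subseteq> J" and J: "J \<subseteq> {1..s-1} \<times> {1..t-1}" and B: "B \<in> I \<rightarrow>\<^sub>E {-1, 0, 1}"
  defines "V \<equiv> verts (matrix_graph s t I B)"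
  shows "card {A \<in> chio_ext s t J \<rightarrow>\<^sub>E {-1, 1}. \<forall>p\<in>I. chio_map s t J A p = B p} =
    2 ^ card (chio_ext s t J - I - V) * card (switchings s t I B)"
proof -
  define E where "E = chio_ext s t J"
  \<comment> \<open>The unconstrained positions, among them the corner
    \<open>(s, t)\<close>.\<close>
  define R where "R = E - I - V"
  \<comment> \<open>By \<open>chio_entry_iff\<close>, this is the forced entry on \<open>I\<close>
    up to the common factor at the corner.\<close>
  define w :: "(nat \<times> nat \<Rightarrow> bit) \<Rightarrow> nat \<times> nat \<Rightarrow> int"
    where "w f = (\<lambda>(i, j). if B (i, j) = 0 then bit_sign (f (i, t)) * bit_sign (f (s, j))
      else B (i, j))" for f
  define bits :: "(nat \<times> nat \<Rightarrow> int) \<Rightarrow> nat \<times> nat \<Rightarrow> bit"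
    where "bits A v = of_bool (v \<in> V \<and> A v = -1)" for A v
  \<comment> \<open>The inverse of reading off the free entries and the vertex bits. A position of
    \<open>E\<close> outside \<open>R\<close> and \<open>V\<close> lies in \<open>I\<close>, where
    the entry is forced.\<close>
  define fill :: "(nat \<times> nat \<Rightarrow> int) \<times> (nat \<times> nat \<Rightarrow> bit) \<Rightarrow> nat \<times> nat \<Rightarrow> int"
    where "fill = (\<lambda>(a, f). \<lambda>p\<in>E. if p \<in> R then a p else if p \<in> V then bit_sign (f p)
      else a (s, t) * w f p)"
  let ?S = "{A \<in> E \<rightarrow>\<^sub>E {-1, 1}. \<forall>p\<in>I. chio_map s t J A p = B p}"
  let ?F = "switchings s t I B"
  have finJ: "finite J" using J by (rule finite_subset) simp
  then have finR: "finite R" by (simp add: R_def E_def finite_chio_ext)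
  have V: "V = {(i, t) | i. i \<in> fst ` I} \<union> {(s, j) | j. j \<in> snd ` I}"
    by (simp add: V_def matrix_graph_def)
  have bound: "i < s" "j < t" if "(i, j) \<in> J" for i j using that J by fastforce+
  have IE: "I \<subseteq> E" using assms(1) by (auto simp: E_def chio_ext_def)
  have VE: "V \<subseteq> E" and IV: "I \<inter> V = {}"
    using verts_matrix_graph_subset[OF assms(1) J, of B] by (auto simp: V_def E_def)
  have stE: "(s, t) \<in> E" by (simp add: E_def chio_ext_def)
  have stR: "(s, t) \<in> R" using stE assms(1) by (fastforce simp: R_def V dest: bound)
  have inV: "(i, t) \<in> V" "(s, j) \<in> V" if "(i, j) \<in> I" for i j
    using that by (force simp: V)+
  have partition: "p \<in> R \<or> p \<in> V \<and> p \<notin> R \<or> p \<in> I \<and> p \<notin> R \<and> p \<notin> V" if "p \<in> E" for p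
    using that IV by (auto simp: R_def)
  have Bval: "B p \<in> {-1, 0, 1}" if "p \<in> I" for p using B that by auto
  have entry: "chio_map s t J A (i, j) = B (i, j) \<longleftrightarrow>
      A (i, j) = A (s, t) * (if B (i, j) = 0 then A (i, t) * A (s, j) else B (i, j)) \<and>
      (B (i, j) \<noteq> 0 \<longrightarrow> A (i, t) * A (s, j) = - B (i, j))"
    if A: "A \<in> E \<rightarrow>\<^sub>E {-1, 1}" and ij: "(i, j) \<in> I" for A i j
  proof -
    have "(i, j) \<in> E" "(i, t) \<in> E" "(s, j) \<in> E" using IE VE inV ij by auto
    then have "A (i, j) \<in> {-1, 1}" "A (s, t) \<in> {-1, 1}" "A (i, t) \<in> {-1, 1}" "A (s, j) \<in> {-1, 1}"
      using A stE by (blast dest: PiE_mem)+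
    moreover have "chio_map s t J A (i, j) = (A (i, j) * A (s, t) - A (i, t) * A (s, j)) div 2"
      using ij assms(1) by (auto simp: chio_map_def)
    ultimately show ?thesis using chio_entry_iff Bval[OF ij] by presburger
  qed
  have bit_sign_bits: "bit_sign (bits A v) = A v" if "A \<in> E \<rightarrow>\<^sub>E {-1, 1}" "v \<in> V" for A v
  proof -
    have "A v \<in> {-1, 1}" using that VE by blast
    then show ?thesis using that(2) by (auto simp: bits_def bit_sign_def)
  qed
  have bits_bit_sign: "of_bool (bit_sign b = -1) = b" for b
    by (cases b) (simp_all add: bit_sign_def)
  have bit_sign_eq: "bit_sign b = - c \<longleftrightarrow> b = of_bool (c = 1)" if "c \<in> {-1, 1}" for b c
    using that by (cases b) (auto simp: bit_sign_def)
  have bit_sign_val: "bit_sign b \<in> {-1, 1}" for b by (simp add: bit_sign_def)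
  have entry_fill: "fill (a, f) \<in> E \<rightarrow>\<^sub>E {-1, 1}"
    if a: "a \<in> R \<rightarrow>\<^sub>E {-1, 1}" for a f
  proof (rule PiE_I)
    fix p assume p: "p \<in> E"
    have ast: "a (s, t) \<in> {-1, 1}" using a stR by blast
    have "w f p \<in> {-1, 1}" if "p \<in> I"
    proof (cases p)
      case (Pair i j)
      then show ?thesis
        using Bval[OF that] bit_sign_val[of "f (i, t)"] bit_sign_val[of "f (s, j)"]
        by (auto simp: w_def)
    qed
    then show "fill (a, f) p \<in> {-1, 1}"
      using partition[OF p] p a ast bit_sign_val[of "f p"] by (auto simp: fill_def)
  qed (simp add: fill_def)
  have "bij_betw (\<lambda>A. (restrict A R, bits A)) ?S ((R \<rightarrow>\<^sub>E {-1, 1}) \<times> ?F)"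
  proof (rule bij_betw_byWitness[where f' = fill])
    show "\<forall>A\<in>?S. fill (restrict A R, bits A) = A"
    proof (intro ballI ext)
      fix A p assume "A \<in> ?S"
      then have A: "A \<in> E \<rightarrow>\<^sub>E {-1, 1}" and AB: "\<And>p. p \<in> I \<Longrightarrow> chio_map s t J A p = B p" by auto
      show "fill (restrict A R, bits A) p = A p"
      proof (cases "p \<in> E")
        case True
        have "A p = A (s, t) * w (bits A) p" if "p \<in> I"
        proof (cases p)
          case (Pair i j)
          then show ?thesis
            using that AB entry[OF A] bit_sign_bits[OF A] inV by (auto simp: w_def)
        qed
        then show ?thesis
          using partition[OF True] True stR bit_sign_bits[OF A] by (auto simp: fill_def)
      next
        case False
        then show ?thesis using PiE_arb[OF A] by (simp add: fill_def)
      qed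
    qed
    show "\<forall>x\<in>(R \<rightarrow>\<^sub>E {-1, 1}) \<times> ?F. (restrict (fill x) R, bits (fill x)) = x"
    proof (clarify, intro conjI ext)
      fix a f p assume a: "a \<in> R \<rightarrow>\<^sub>E {-1, 1 :: int}" and f: "f \<in> ?F"
      show "restrict (fill (a, f)) R p = a p"
        using PiE_arb[OF a] by (auto simp: fill_def R_def)
      \<comment> \<open>Off \<open>V\<close> the bits read back are 0 by definition, so the chain
        must vanish there too.\<close>
      have "f p = 0" if "p \<notin> V"
        using f that by (simp add: switchings_def chains0_def V_def del: split_paired_All)
      then show "bits (fill (a, f)) p = f p"
        using VE by (auto simp: bits_def fill_def R_def bits_bit_sign)
    qed
    show "(\<lambda>A. (restrict A R, bits A)) ` ?S \<subseteq> (R \<rightarrow>\<^sub>E {-1, 1}) \<times> ?F"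
    proof clarify
      fix A assume A: "A \<in> E \<rightarrow>\<^sub>E {-1, 1}" and AB: "\<forall>p\<in>I. chio_map s t J A p = B p"
      have "bits A (i, t) + bits A (s, j) = of_bool (B (i, j) = 1)" if "(i, j) \<in> Supp I B" for i j
      proof -
        have ij: "(i, j) \<in> I" "B (i, j) \<noteq> 0" using that by (auto simp: Supp_def)
        then have "A (i, t) * A (s, j) = - B (i, j)" using AB entry[OF A] by blast
        then have "bit_sign (bits A (i, t) + bits A (s, j)) = - B (i, j)"
          using bit_sign_bits[OF A] inV[OF ij(1)] by (simp add: bit_sign_add)
        then show ?thesis using bit_sign_eq Bval ij by blast
      qed
      moreover have "bits A \<in> chains0 (matrix_graph s t I B)"
        by (simp add: chains0_def bits_def V_def)
      ultimately have "bits A \<in> ?F" by (auto simp: switchings_def)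
      moreover have "restrict A R \<in> R \<rightarrow>\<^sub>E {-1, 1}" using A by (auto simp: R_def)
      ultimately show "restrict A R \<in> R \<rightarrow>\<^sub>E {-1, 1} \<and> bits A \<in> ?F" by blast
    qed
    show "fill ` ((R \<rightarrow>\<^sub>E {-1, 1}) \<times> ?F) \<subseteq> ?S"
    proof clarify
      fix a f assume a: "a \<in> R \<rightarrow>\<^sub>E {-1, 1 :: int}" and f: "f \<in> ?F"
      have "chio_map s t J (fill (a, f)) (i, j) = B (i, j)" if ij: "(i, j) \<in> I" for i j
      proof -
        have "fill (a, f) (i, t) = bit_sign (f (i, t))" "fill (a, f) (s, j) = bit_sign (f (s, j))"
          using inV[OF ij] VE by (auto simp: fill_def R_def)
        moreover have "fill (a, f) (s, t) = a (s, t)" "fill (a, f) (i, j) = a (s, t) * w f (i, j)"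
          using stR stE ij IE IV by (auto simp: fill_def R_def)
        moreover have "bit_sign (f (i, t)) * bit_sign (f (s, j)) = - B (i, j)" if "B (i, j) \<noteq> 0"
        proof -
          have "f (i, t) + f (s, j) = of_bool (B (i, j) = 1)"
            using f ij that by (auto simp: switchings_def Supp_def)
          then show ?thesis
            using bit_sign_eq Bval[OF ij] that by (simp flip: bit_sign_add)
        qed
        ultimately show ?thesis
          unfolding entry[OF entry_fill[OF a] ij] by (simp add: w_def)
      qed
      then show "fill (a, f) \<in> E \<rightarrow>\<^sub>E {-1, 1} \<and> (\<forall>p\<in>I. chio_map s t J (fill (a, f)) p = B p)"
        using entry_fill[OF a] by auto
    qed
  qed
  then have "card ?S = card ((R \<rightarrow>\<^sub>E {-1, 1 :: int}) \<times> ?F)" by (rule bij_betw_same_card)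
  also have "\<dots> = 2 ^ card R * card ?F"
    using finR by (simp add: card_cartesian_product card_funcsetE numeral_2_eq_2)
  finally show ?thesis by (simp add: E_def R_def)
qed

text \<open>The event is a product box, so independence gives a product over \<open>J\<close>. Each
  entry of \<open>I\<close> contributes 1/2, with a further 1/2 if it is nonzero.\<close>

lemma lcf_prob_entry_event:
  assumes "finite J" and "I \<subseteq> J" and "B \<in> I \<rightarrow>\<^sub>E {-1, 0, 1}"
  shows "lcf_prob J (entry_event J I B) = (1 / 2) ^ (card I + card (Supp I B))"
proof -
  let ?T = "\<lambda>p. if p \<in> I then {B p} else {-1, 0, 1}"
  have finI: "finite I" using assms finite_subset by blast
  have ext: "B p = undefined" if "p \<notin> I" for p using assms(3) that by auto
  have "entry_event J I B = PiE_dflt J undefined ?T"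
  proof (rule set_eqI)
    fix B'
    have "restrict B' I = B \<longleftrightarrow> (\<forall>p\<in>I. B' p = B p)"
      using ext by (auto simp: fun_eq_iff restrict_def)
    moreover have "B' \<in> J \<rightarrow>\<^sub>E {-1, 0, 1} \<and> (\<forall>p\<in>I. B' p = B p) \<longleftrightarrow> B' \<in> PiE_dflt J undefined ?T"
    proof
      assume "B' \<in> J \<rightarrow>\<^sub>E {-1, 0, 1} \<and> (\<forall>p\<in>I. B' p = B p)"
      then show "B' \<in> PiE_dflt J undefined ?T"
        unfolding PiE_dflt_def by (simp add: PiE_iff extensional_def del: split_paired_All)
    next
      assume "B' \<in> PiE_dflt J undefined ?T"
      then have R: "\<And>p. p \<in> J \<Longrightarrow> B' p \<in> ?T p" "\<And>p. p \<notin> J \<Longrightarrow> B' p = undefined"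
        unfolding PiE_dflt_def by blast+
      have BI: "B' p = B p" if "p \<in> I" for p using R(1)[of p] that assms(2) by auto
      have "B' p \<in> {-1, 0, 1}" if "p \<in> J" for p
      proof (cases "p \<in> I")
        case True
        then show ?thesis using PiE_mem[OF assms(3) True] BI by simp
      next
        case False
        then show ?thesis using R(1)[OF that] by simp
      qed
      then show "B' \<in> J \<rightarrow>\<^sub>E {-1, 0, 1} \<and> (\<forall>p\<in>I. B' p = B p)"
        using R(2) BI by blast
    qed
    ultimately show "B' \<in> entry_event J I B \<longleftrightarrow> B' \<in> PiE_dflt J undefined ?T"
      by (simp add: entry_event_def)
  qed
  then have "lcf_prob J (entry_event J I B)
      = (\<Prod>p\<in>J. measure_pmf.prob lazy_coin (?T p))"
    using assms(1) by (simp add: lcf_prob_def measure_Pi_pmf_PiE_dflt)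
  \<comment> \<open>Outside \<open>I\<close> the factor is the total mass 1.\<close>
  also have "\<dots> = (\<Prod>p\<in>I. measure_pmf.prob lazy_coin (?T p))"
    using assms(1,2)
    by (intro prod.mono_neutral_right) (auto simp: measure_measure_pmf_finite pmf_lazy_coin)
  also have "\<dots> = (\<Prod>p\<in>I. 1 / 2 * (if B p \<noteq> 0 then 1 / 2 else 1))"
  proof (rule prod.cong[OF refl])
    fix p assume "p \<in> I"
    then have "B p \<in> {-1, 0, 1}" using assms(3) by auto
    then show "measure_pmf.prob lazy_coin (?T p) = 1 / 2 * (if B p \<noteq> 0 then 1 / 2 else 1)"
      using \<open>p \<in> I\<close> by (auto simp: measure_pmf_single pmf_lazy_coin)
  qed
  also have "\<dots> = (1 / 2) ^ card I * (\<Prod>p\<in>Supp I B. 1 / 2)"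
    unfolding prod.distrib Supp_def prod.inter_filter[OF finI] by simp
  finally show ?thesis by (simp add: power_add)
qed

text \<open>The Chio extension splits into \<open>I\<close>, the vertices and the free positions;
  the power of 2 counting the free entries cancels against the normalisation.\<close>

lemma chio_prob_entry_event_switchings:
  assumes "I \<subseteq> J" and "J \<subseteq> {1..s-1} \<times> {1..t-1}" and "B \<in> I \<rightarrow>\<^sub>E {-1, 0, 1}"
  shows "chio_prob s t J (entry_event J I B) =
    (1 / 2) ^ (card I + f0 (matrix_graph s t I B)) * real (card (switchings s t I B))"
proof -
  let ?E = "chio_ext s t J" and ?V = "verts (matrix_graph s t I B)"
  have finJ: "finite J" using assms(2) by (rule finite_subset) simp
  have IE: "I \<subseteq> ?E" using assms(1) by (auto simp: chio_ext_def)
  have VE: "?V \<subseteq> ?E - I" by (rule verts_matrix_graph_subset) fact+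
  have finE: "finite ?E" by (rule finite_chio_ext[OF finJ])
  then have finV: "finite ?V" and finI: "finite I"
    using IE VE by (meson finite_subset finite_Diff)+
  have "card I \<le> card ?E" using finE IE by (rule card_mono)
  moreover have "card ?V \<le> card (?E - I)" using finE VE by (intro card_mono) auto
  ultimately have "card ?E = card I + f0 (matrix_graph s t I B) + card (?E - I - ?V)"
    using finI finV IE VE by (simp add: card_Diff_subset f0_def)
  moreover have "B \<in> extensional I" using assms(3) by (simp add: PiE_def)
  ultimately show ?thesis
    unfolding chio_prob_entry_event[OF finJ assms(1) \<open>B \<in> extensional I\<close>] card_chio_fibre[OF assms]
    by (simp add: power_add power_one_over)
qed

section \<open>Switchings as solutions of a coboundary equation\<close>

lemma edges_matrix_graph: "edges (matrix_graph s t I B) = entry_edge s t ` Supp I B"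
  by (simp add: matrix_graph_def)

lemma edge_matrix_graphE:
  assumes "e \<in> edges (matrix_graph s t I B)"
  obtains i j where "(i, j) \<in> Supp I B" "e = {(i, t), (s, j)}"
  using assms by (auto simp: matrix_graph_def entry_edge_def)

lemma edge_matrix_graphI: "(i, j) \<in> Supp I B \<Longrightarrow> {(i, t), (s, j)} \<in> edges (matrix_graph s t I B)"
  by (force simp: matrix_graph_def entry_edge_def)

text \<open>Support entries correspond to edges, with \<sigma> reading off \<open>B\<close>. As a
  fibre of the coboundary map, the switchings can be counted by \<open>card_coboundary_fibre\<close>
  once one exists.\<close>

lemma switchings_eq_fibre:
  fixes B :: "nat \<times> nat \<Rightarrow> int"
  assumes "I \<subseteq> {1..s-1} \<times> {1..t-1}"
  defines "X \<equiv> matrix_graph s t I B" and "\<sigma> \<equiv> matrix_sign s t I B"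
  shows "switchings s t I B =
    {f \<in> chains0 X. coboundary X f = (\<lambda>e. of_bool (e \<in> edges X \<and> \<sigma> e = 1))}"
proof -
  have simple: "simple_graph X" unfolding X_def by (rule simple_graph_matrix_graph[OF assms(1)])
  have "(\<forall>(i, j)\<in>Supp I B. f (i, t) + f (s, j) = of_bool (B (i, j) = 1)) \<longleftrightarrow>
      coboundary X f = (\<lambda>e. of_bool (e \<in> edges X \<and> \<sigma> e = 1))" for f
  proof -
    have edge: "coboundary X f {(i, t), (s, j)} = f (i, t) + f (s, j)"
      "\<sigma> {(i, t), (s, j)} = B (i, j)" "{(i, t), (s, j)} \<in> edges X" if "(i, j) \<in> Supp I B" for i j
      using that coboundary_doubleton[OF simple] edge_matrix_graphI
        matrix_sign_entry_edge[OF assms(1)] by (auto simp: X_def \<sigma>_def)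
    have "coboundary X f = (\<lambda>e. of_bool (e \<in> edges X \<and> \<sigma> e = 1)) \<longleftrightarrow>
        (\<forall>e\<in>edges X. coboundary X f e = of_bool (\<sigma> e = 1))"
      by (auto simp: fun_eq_iff coboundary_def)
    also have "\<dots> \<longleftrightarrow> (\<forall>(i, j)\<in>Supp I B. f (i, t) + f (s, j) = of_bool (B (i, j) = 1))"
      using edge by (fastforce simp: X_def elim!: edge_matrix_graphE)
    finally show ?thesis by simp
  qed
  then show ?thesis by (auto simp: switchings_def X_def)
qed

lemma switchings_nonempty_iff_balanced:
  assumes "I \<subseteq> {1..s-1} \<times> {1..t-1}" and B: "B \<in> I \<rightarrow>\<^sub>E {-1, 0, 1}"
  defines "X \<equiv> matrix_graph s t I B" and "\<sigma> \<equiv> matrix_sign s t I B"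
  shows "switchings s t I B \<noteq> {} \<longleftrightarrow> balanced X \<sigma>"
proof -
  have simple: "simple_graph X" unfolding X_def by (rule simple_graph_matrix_graph[OF assms(1)])
  have finI: "finite I" using assms(1) by (rule finite_subset) simp
  then have fin: "finite (verts X)" by (simp add: X_def matrix_graph_def setcompr_eq_image)
  \<comment> \<open>\<open>X\<close> is bipartite, so flipping all vertices in column \<open>t\<close> negates the sign of every edge.\<close>
  define \<kappa> :: "nat \<times> nat \<Rightarrow> bit" where "\<kappa> v = of_bool (v \<in> verts X \<and> snd v = t)" for v
  have \<kappa>0: "\<kappa> \<in> chains0 X" by (simp add: \<kappa>_def chains0_def)
  have \<kappa>: "coboundary X \<kappa> e = 1" and \<sigma>: "\<sigma> e \<in> {-1, 1}" if e: "e \<in> edges X" for e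
  proof -
    obtain i j where ij: "(i, j) \<in> Supp I B" and eq: "e = {(i, t), (s, j)}"
      using e unfolding X_def by (rule edge_matrix_graphE)
    have "\<sigma> e = B (i, j)"
      using matrix_sign_entry_edge[OF assms(1) ij] by (simp add: \<sigma>_def eq)
    then show "\<sigma> e \<in> {-1, 1}" using ij B by (auto simp: Supp_def)
    have "(i, j) \<in> {1..s-1} \<times> {1..t-1}" using ij assms(1) unfolding Supp_def by blast
    \<comment> \<open>Hence \<kappa> marks exactly one end of the edge.\<close>
    then have "j \<noteq> t" by auto
    then show "coboundary X \<kappa> e = 1"
      using e coboundary_doubleton[OF simple, of "(i, t)" "(s, j)" \<kappa>]
        simple_graph_edge_doubleton[OF simple, of "(i, t)" "(s, j)"]
      by (simp add: eq \<kappa>_def)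
  qed
  \<comment> \<open>Every edge has sign 1 or -1, so adding the constant 1 interchanges the
    indicators of positive and negative edges.\<close>
  have shift: "coboundary X (\<lambda>v. f v + \<kappa> v) e = of_bool (\<sigma> e = -1) \<longleftrightarrow>
      coboundary X f e = of_bool (\<sigma> e = 1)" if "e \<in> edges X" for f e
    using \<kappa>[OF that] \<sigma>[OF that] by (cases "coboundary X f e") (auto simp: coboundary_add)
  have "balanced X \<sigma> \<longleftrightarrow> (\<exists>f\<in>chains0 X. \<forall>e\<in>edges X. coboundary X f e = of_bool (\<sigma> e = -1))"
    by (rule balanced_iff_coboundary[OF simple fin])
  also have "\<dots> \<longleftrightarrow> (\<exists>f\<in>chains0 X. \<forall>e\<in>edges X. coboundary X f e = of_bool (\<sigma> e = 1))"
  proof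
    assume "\<exists>f\<in>chains0 X. \<forall>e\<in>edges X. coboundary X f e = of_bool (\<sigma> e = 1)"
    then obtain f where "f \<in> chains0 X" "\<forall>e\<in>edges X. coboundary X f e = of_bool (\<sigma> e = 1)" by blast
    then show "\<exists>f\<in>chains0 X. \<forall>e\<in>edges X. coboundary X f e = of_bool (\<sigma> e = -1)"
      using \<kappa>0 shift by (intro bexI[of _ "\<lambda>v. f v + \<kappa> v"]) (auto simp: chains0_def)
  next
    assume "\<exists>f\<in>chains0 X. \<forall>e\<in>edges X. coboundary X f e = of_bool (\<sigma> e = -1)"
    then obtain f where f: "f \<in> chains0 X" "\<forall>e\<in>edges X. coboundary X f e = of_bool (\<sigma> e = -1)"
      by blast
    have "(\<lambda>v. (f v + \<kappa> v) + \<kappa> v) = f" by (simp add: fun_eq_iff add.assoc)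
    then have "\<forall>e\<in>edges X. coboundary X (\<lambda>v. f v + \<kappa> v) e = of_bool (\<sigma> e = 1)"
      using f(2) shift[of _ "\<lambda>v. f v + \<kappa> v"] by simp
    then show "\<exists>f\<in>chains0 X. \<forall>e\<in>edges X. coboundary X f e = of_bool (\<sigma> e = 1)"
      using f(1) \<kappa>0 by (intro bexI[of _ "\<lambda>v. f v + \<kappa> v"]) (auto simp: chains0_def)
  qed
  also have "\<dots> \<longleftrightarrow> switchings s t I B \<noteq> {}"
    unfolding switchings_eq_fibre[OF assms(1)] X_def[symmetric] \<sigma>_def[symmetric]
    by (auto simp: fun_eq_iff coboundary_def)
  finally show ?thesis by simp
qed

section \<open>Assembling the three equivalences\<close>

theorem theorem30:
  fixes s t :: nat and I J :: "(nat \<times> nat) set" and B :: "nat \<times> nat \<Rightarrow> int"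
  assumes "2 \<le> s" and "2 \<le> t"
    and "I \<subseteq> J" and "J \<subseteq> {1..s-1} \<times> {1..t-1}"
    and "B \<in> I \<rightarrow>\<^sub>E {-1, 0, 1}"
  defines "X \<equiv> matrix_graph s t I B"
    and "\<sigma> \<equiv> matrix_sign s t I B"
    and "P \<equiv> chio_prob s t J (entry_event J I B)"
    and "L \<equiv> lcf_prob J (entry_event J I B)"
  shows "(P > 0 \<longleftrightarrow> balanced X \<sigma>) \<and>
    (P > 0 \<longleftrightarrow>
      P = (1 / 2) powi (int (card I) + int (f0 X) - int (beta0 X)) \<and>
      (1 / 2) powi (int (card I) + int (f0 X) - int (beta0 X)) =
        (1 / 2) ^ card I / real (card (coboundary_space X))) \<and>
    (P > 0 \<longleftrightarrow>
      P = 2 ^ beta1 X * L \<and>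
      2 ^ beta1 X * L = real (card (cycle_space X)) * L)"
proof -
  have I: "I \<subseteq> {1..s-1} \<times> {1..t-1}" using assms(3,4) by blast
  have finJ: "finite J" using assms(4) by (rule finite_subset) simp
  have simple: "simple_graph X" unfolding X_def by (rule simple_graph_matrix_graph[OF I])
  have finI: "finite I" using finJ assms(3) by (rule finite_subset[rotated])
  then have fin: "finite (verts X)" by (simp add: X_def matrix_graph_def setcompr_eq_image)
  define N where "N = card (switchings s t I B)"
  have P: "P = (1 / 2) ^ (card I + f0 X) * real N"
    unfolding P_def X_def N_def by (rule chio_prob_entry_event_switchings) fact+
  have "finite (switchings s t I B)"
    using finite_supported[OF fin]
    by (rule finite_subset[rotated]) (auto simp: switchings_def chains0_def X_def)
  then have N0: "N > 0 \<longleftrightarrow> balanced X \<sigma>"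
    using switchings_nonempty_iff_balanced[OF I assms(5)]
    by (simp add: N_def X_def \<sigma>_def card_gt_0_iff)
  have N1: "N = 2 ^ beta0 X" if "N > 0"
  proof -
    have "switchings s t I B \<noteq> {}" using that by (auto simp: N_def)
    then have "N = card (cocycles0 X)"
      unfolding N_def switchings_eq_fibre[OF I] X_def[symmetric] using card_coboundary_fibre by blast
    then show ?thesis using card_cocycles0[OF simple fin] by simp
  qed
  let ?Q = "(1 / 2 :: real) ^ card I / real (card (coboundary_space X))"
  have B1: "real (card (coboundary_space X)) * 2 ^ beta0 X = 2 ^ f0 X"
    using card_coboundary_space[OF simple fin] by (metis of_nat_mult of_nat_numeral of_nat_power)
  then have C: "real (card (coboundary_space X)) \<noteq> 0"
    by (metis mult_zero_left power_not_zero zero_neq_numeral)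
  have Q: "?Q = (1 / 2) ^ (card I + f0 X) * 2 ^ beta0 X"
    using B1 C by (simp add: field_simps power_add power_one_over)
  \<comment> \<open>The closed forms agree with \<open>?Q\<close> whether or not the probability is
    positive; \<open>Z1\<close> below does the same for the lazy coin flip side.\<close>
  have powi: "(1 / 2 :: real) powi (int (card I) + int (f0 X) - int (beta0 X)) = ?Q"
    unfolding Q by (simp add: power_int_diff power_add power_one_over field_simps flip: of_nat_add)
  have "card (edges X) = card (Supp I B)"
    unfolding X_def edges_matrix_graph
    by (rule card_image) (rule inj_on_subset[OF inj_on_entry_edge[OF I]], auto simp: Supp_def)
  then have L: "L = (1 / 2) ^ (card I + card (edges X))"
    unfolding L_def by (simp add: lcf_prob_entry_event[OF finJ assms(3,5)])
  have "real (card (cycle_space X)) * real (card (coboundary_space X)) = 2 ^ card (edges X)"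
    using card_cycle_space_coboundary_space[OF simple fin]
    by (metis of_nat_mult of_nat_numeral of_nat_power)
  then have Z1: "real (card (cycle_space X)) * L = ?Q"
    unfolding L using C by (simp add: field_simps power_add power_one_over)
  have beta1: "real (card (cycle_space X)) = 2 ^ beta1 X"
    by (simp add: card_cycle_space[OF simple fin])
  have "P > 0 \<longleftrightarrow> N > 0" by (simp add: P zero_less_mult_iff)
  moreover have "P = ?Q" if "N > 0" using N1[OF that] by (simp add: P Q)
  \<comment> \<open>This gives the converse directions: equality with a closed form forces a
    positive probability.\<close>
  moreover have "?Q > 0" unfolding Q by simp
  ultimately show ?thesis using N0 powi Z1 beta1 by metis
qed

end
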